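(* Let $0<\varepsilon\le RL$, let the noise be independent Gaussian, $e_k\sim N(0,s^2)$, and run the method $x_{k+1}=x_k-h_0(g_k+e_k)$, $k=0,\dots,N-1$, with constant steps $h_k\equiv h_0$ and uniform averaging $x_A=\frac1{N+1}\sum_{k=0}^Nx_k$, where $h_0>0$ is arbitrary and may depend on $N$ and the problem parameters. Then $$\mathcal E_N\;\le\;\frac34\cdot\frac{\varepsilon^2N}{2R^2s^2}\,\big(1+o(1)\big),$$ with $o(1)\to0$ as $N\to\infty$ at fixed $\varepsilon,R,L,s$, uniformly in $h_0$.
   Context: Let $x_0\in\mathbb R$ and $R,L,s>0$. Let $\mathcal C=\mathcal C(R,L)$ be the class of convex (possibly nonsmooth) functions $f:\mathbb R\to\mathbb R$ admitting a minimizer $x_\star$ with $|x_0-x_\star|\le R$ and all of whose subgradients at all points are bounded by $L$ in absolute value; write $f_\star=f(x_\star)$. For an instance $f$ the oracle uses a measurable selection $x\mapsto g(x)\in\partial f(x)$, and $g_k=g(x_k)$. The noise variables $e_0,\dots,e_{N-1}$ are i.i.d. $N(0,s^2)$, and $$\mathcal E_N=-\log\,\sup_f\ \mathbb P\big(f(x_A)-f_\star\ge\varepsilon\big),$$ the supremum running over all $f\in\mathcal C$ together with all measurable subgradient selections of the oracle. *)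

theory Defs
  imports "HOL-Probability.Probability"
begin

definition subdifferential :: "(real \<Rightarrow> real) \<Rightarrow> real \<Rightarrow> real set" where
  "subdifferential f x = {v. \<forall>y. f y \<ge> f x + v * (y - x)}"

definition problem_class :: "real \<Rightarrow> real \<Rightarrow> real \<Rightarrow> (real \<Rightarrow> real) set" where
  "problem_class x0 R L =
     {f. convex_on UNIV f
       \<and> (\<exists>xstar. is_arg_min f (\<lambda>_. True) xstar \<and> \<bar>x0 - xstar\<bar> \<le> R)
       \<and> (\<forall>x. \<forall>v \<in> subdifferential f x. \<bar>v\<bar> \<le> L)}"

(* The value at an arbitrary global minimizer; all minimizers share it. *)
definition min_value :: "(real \<Rightarrow> real) \<Rightarrow> real" where
  "min_value f = f (ARG_MIN f x. True)"

definition subgradient_oracles :: "(real \<Rightarrow> real) \<Rightarrow> (real \<Rightarrow> real) set" where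
  "subgradient_oracles f =
     {g. g \<in> borel_measurable borel \<and> (\<forall>x. g x \<in> subdifferential f x)}"

(* Here e is one realization of the noise sequence. *)
primrec iterate :: "real \<Rightarrow> real \<Rightarrow> (real \<Rightarrow> real) \<Rightarrow> (nat \<Rightarrow> real) \<Rightarrow> nat \<Rightarrow> real" where
  "iterate x0 h0 g e 0 = x0"
| "iterate x0 h0 g e (Suc k) = iterate x0 h0 g e k - h0 * (g (iterate x0 h0 g e k) + e k)"

definition averaged_iterate ::
    "real \<Rightarrow> real \<Rightarrow> (real \<Rightarrow> real) \<Rightarrow> (nat \<Rightarrow> real) \<Rightarrow> nat \<Rightarrow> real" where
  "averaged_iterate x0 h0 g e N = (\<Sum>k=0..N. iterate x0 h0 g e k) / (real N + 1)"

(* Only the noise variables with index below N are constrained; no later ones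
   enter the first N steps.  The parameter s is the standard deviation. *)
definition iid_gaussian_noise :: "'a measure \<Rightarrow> (nat \<Rightarrow> 'a \<Rightarrow> real) \<Rightarrow> real \<Rightarrow> nat \<Rightarrow> bool" where
  "iid_gaussian_noise M e s N \<longleftrightarrow>
     prob_space M
     \<and> prob_space.indep_vars M (\<lambda>_. borel) e {..<N}
     \<and> (\<forall>k<N. distributed M lborel (e k) (normal_density 0 s))"

definition worst_case_failure_prob ::
    "'a measure \<Rightarrow> (nat \<Rightarrow> 'a \<Rightarrow> real) \<Rightarrow> real \<Rightarrow> real \<Rightarrow> real \<Rightarrow> real \<Rightarrow> real \<Rightarrow> nat \<Rightarrow> real" where
  "worst_case_failure_prob M e x0 R L \<epsilon> h0 N =
     (SUP (f, g) \<in> (SIGMA f : problem_class x0 R L. subgradient_oracles f).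
        measure M {\<omega> \<in> space M.
          f (averaged_iterate x0 h0 g (\<lambda>k. e k \<omega>) N) - min_value f \<ge> \<epsilon>})"

(* Extended-real valued, so that a vanishing failure probability gives the exponent
   infinity; the real logarithm has ln 0 = 0, which would give the exponent 0. *)
definition error_exponent ::
    "'a measure \<Rightarrow> (nat \<Rightarrow> 'a \<Rightarrow> real) \<Rightarrow> real \<Rightarrow> real \<Rightarrow> real \<Rightarrow> real \<Rightarrow> real \<Rightarrow> nat \<Rightarrow> ereal" where
  "error_exponent M e x0 R L \<epsilon> h0 N =
     (let p = worst_case_failure_prob M e x0 R L \<epsilon> h0 N
      in if p = 0 then \<infinity> else ereal (- ln p))"

end

theory Submission
  imports Defs "HOL-Real_Asymp.Real_Asymp"
begin

text \<open>
  A single instance suffices: \<open>f x = a * \<bar>x - xs\<bar>\<close> with slope \<open>a = \<epsilon> / R\<close> and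
  \<open>xs = x0 - R\<close>, for which the method fails as soon as \<open>x\<^sub>A \<ge> x0\<close>.
  Subgradients never exceed \<open>a\<close>, so \<open>x\<^sub>A\<close> is at least what the constant gradient \<open>a\<close>
  would produce, and \<open>x\<^sub>A \<ge> x0\<close> follows from \<open>\<Sum>j<N. (N - j) * (a + e j) \<le> 0\<close>, an event that
  does not involve \<open>h0\<close>.  This weighted sum is Gaussian with mean \<open>a * N * (N + 1) / 2\<close> and
  variance \<open>s\<^sup>2 * N * (N + 1) * (2 * N + 1) / 6\<close>, and the Gaussian tail gives the exponent
  \<open>3 * a\<^sup>2 * N / (8 * s\<^sup>2)\<close> to leading order.
\<close>

section \<open>The scaled absolute value as an instance\<close>

lemma convex_on_scaled_abs_diff:
  fixes a c :: real
  assumes "a \<ge> 0"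
  shows "convex_on UNIV (\<lambda>x. a * \<bar>x - c\<bar>)"
proof -
  have "convex_on UNIV (\<lambda>x. a * dist c x)"
    by (intro convex_on_cmul assms convex_on_dist) auto
  then show ?thesis
    by (simp add: dist_real_def abs_minus_commute)
qed

text \<open>The triangle inequality turns the subgradient inequality into
  \<open>v * (y - x) \<le> a * \<bar>y - x\<bar>\<close>; the points \<open>x + 1\<close> and
  \<open>x - 1\<close> bound \<open>v\<close> from both sides.\<close>

lemma subdifferential_scaled_abs_diff_bound:
  assumes "a \<ge> 0" and v: "v \<in> subdifferential (\<lambda>x. a * \<bar>x - c\<bar>) x"
  shows "\<bar>v\<bar> \<le> a"
proof -
  have *: "a * \<bar>y - c\<bar> \<ge> a * \<bar>x - c\<bar> + v * (y - x)" for y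
    using v by (auto simp: subdifferential_def)
  have "v * (y - x) \<le> a * \<bar>y - x\<bar>" for y
  proof -
    have "a * \<bar>y - c\<bar> \<le> a * (\<bar>x - c\<bar> + \<bar>y - x\<bar>)"
      using \<open>a \<ge> 0\<close> by (intro mult_left_mono) auto
    with *[of y] show ?thesis
      by (simp add: distrib_left)
  qed
  from this[of "x + 1"] this[of "x - 1"] show ?thesis
    by simp
qed

lemma sign_in_subdifferential_scaled_abs_diff:
  assumes "a \<ge> 0"
  shows "(if x < c then - a else a) \<in> subdifferential (\<lambda>x. a * \<bar>x - c\<bar>) x"
proof -
  have "(if x < c then - 1 else 1) * (y - c) \<le> \<bar>y - c\<bar>" for y :: real
    by auto
  from mult_left_mono[OF this assms] show ?thesis
    by (auto simp: subdifferential_def algebra_simps)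
qed

lemma is_arg_min_scaled_abs_diff:
  fixes a c :: real
  assumes "a \<ge> 0"
  shows "is_arg_min (\<lambda>x. a * \<bar>x - c\<bar>) (\<lambda>_. True) c"
  using assms by (auto simp: is_arg_min_def not_less)

text \<open>\<open>ARG_MIN\<close> is a Hilbert choice: once some minimizer exists, the chosen point
  is one too, and two minimizers have equal values.\<close>

lemma min_value_eqI:
  assumes "is_arg_min f (\<lambda>_. True) x"
  shows "min_value f = f x"
proof -
  have "is_arg_min f (\<lambda>_. True) (ARG_MIN f x. True)"
    unfolding arg_min_def using assms by (rule someI)
  with assms show ?thesis
    unfolding min_value_def is_arg_min_def by (meson linorder_neqE)
qed

section \<open>The averaged iterate as a weighted sum\<close>

lemma iterate_eq_sum:
  "iterate x0 h g e k = x0 - h * (\<Sum>j<k. g (iterate x0 h g e j) + e j)"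
  by (induction k) (auto simp: algebra_simps)

text \<open>Each \<open>u j\<close> is counted once for every \<open>k\<close> with
  \<open>j < k \<le> N\<close>.\<close>

lemma sum_partial_sums:
  fixes u :: "nat \<Rightarrow> real"
  shows "(\<Sum>k=0..N. \<Sum>j<k. u j) = (\<Sum>j<N. (real N - real j) * u j)"
  by (induction N) (simp_all add: algebra_simps sum.distrib sum_subtractf)

lemma averaged_iterate_ge:
  assumes "h \<ge> 0" and "\<And>x. g x \<le> a"
    and noise: "(\<Sum>j<N. (real N - real j) * (a + e j)) \<le> 0"
  shows "averaged_iterate x0 h g e N \<ge> x0"
proof -
  let ?u = "\<lambda>j. g (iterate x0 h g e j) + e j"
  have "(\<Sum>j<N. (real N - real j) * ?u j) \<le> (\<Sum>j<N. (real N - real j) * (a + e j))"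
    using assms(2) by (intro sum_mono mult_left_mono) auto
  with noise have "h * (\<Sum>j<N. (real N - real j) * ?u j) \<le> 0"
    using \<open>h \<ge> 0\<close> by (intro mult_nonneg_nonpos) auto
  moreover have "(\<Sum>k=0..N. iterate x0 h g e k)
      = (real N + 1) * x0 - h * (\<Sum>j<N. (real N - real j) * ?u j)"
    unfolding sum_partial_sums[symmetric]
    \<comment> \<open>Only the outer iterate is unrolled, those inside \<open>g\<close> stay; as a
      simp rule the equation would loop.\<close>
    by (subst iterate_eq_sum) (simp add: sum_subtractf sum_distrib_left algebra_simps)
  ultimately show ?thesis
    by (simp add: averaged_iterate_def field_simps)
qed

section \<open>Moments and tails of the weighted Gaussian sum\<close>

lemma sum_reversed_index: "(\<Sum>j<N. real N - real j) = real N * (real N + 1) / 2"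
  by (induction N) (auto simp: field_simps sum.distrib sum_subtractf)

lemma sum_reversed_index_squares:
  "(\<Sum>j<N. (real N - real j)\<^sup>2) = real N * (real N + 1) * (2 * real N + 1) / 6"
proof -
  \<comment> \<open>Reversing the order makes the summand independent of \<open>N\<close>, so that
    the induction adds a single term.\<close>
  have "(\<Sum>j<N. (real N - real j)\<^sup>2) = (\<Sum>j<N. (real (Suc j))\<^sup>2)"
    by (subst sum.nat_diff_reindex[symmetric]) (intro sum.cong, auto)
  also have "\<dots> = real N * (real N + 1) * (2 * real N + 1) / 6"
    by (induction N) (auto simp: field_simps power2_eq_square)
  finally show ?thesis .
qed

text \<open>On the window of width \<sigma> just below the threshold, the density is at least its
  value at the far end. Having \<open>t + 1\<close> in place of \<open>t\<close> adds only O(t + 1)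
  to the exponent, below the leading order of t squared.\<close>

lemma (in prob_space) normal_lower_tail_ge:
  fixes t \<sigma> :: real
  assumes X: "distributed M lborel X (normal_density 0 \<sigma>)" and "\<sigma> > 0" and "t \<ge> 0"
  shows "prob {\<omega> \<in> space M. X \<omega> \<le> - (t * \<sigma>)} \<ge> exp (- (t + 1)\<^sup>2 / 2) / sqrt (2 * pi)"
proof -
  let ?c = "normal_density 0 \<sigma> ((t + 1) * \<sigma>)"
  let ?I = "{- ((t + 1) * \<sigma>)..- (t * \<sigma>)}"
  have c: "?c * \<sigma> = exp (- (t + 1)\<^sup>2 / 2) / sqrt (2 * pi)"
    using \<open>\<sigma> > 0\<close> by (simp add: normal_density_def real_sqrt_mult power_mult_distrib)
  have ge: "?c \<le> normal_density 0 \<sigma> x" if "x \<in> ?I" for x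
  proof -
    have "t * \<sigma> \<ge> 0"
      using assms by simp
    with that \<open>\<sigma> > 0\<close> have "\<bar>x\<bar> \<le> (t + 1) * \<sigma>"
      by (simp add: distrib_right abs_le_iff)
    then have "x\<^sup>2 \<le> ((t + 1) * \<sigma>)\<^sup>2"
      by (metis abs_ge_zero power2_abs power_mono)
    then show ?thesis
      unfolding normal_density_def
      by (intro mult_left_mono) (auto intro!: divide_right_mono)
  qed
  have "ennreal (?c * \<sigma>) = (\<integral>\<^sup>+x. ennreal ?c * indicator ?I x \<partial>lborel)"
    using \<open>\<sigma> > 0\<close> by (simp add: nn_integral_cmult ennreal_mult algebra_simps)
  also have "\<dots> \<le> (\<integral>\<^sup>+x. ennreal (normal_density 0 \<sigma> x) * indicator {..- (t * \<sigma>)} x \<partial>lborel)"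
    by (intro nn_integral_mono) (auto simp: indicator_def intro!: ennreal_leI ge)
  also have "\<dots> = emeasure M (X -` {..- (t * \<sigma>)} \<inter> space M)"
    by (rule distributed_emeasure[OF X, symmetric]) auto
  also have "X -` {..- (t * \<sigma>)} \<inter> space M = {\<omega> \<in> space M. X \<omega> \<le> - (t * \<sigma>)}"
    by auto
  finally show ?thesis
    unfolding c by (simp add: emeasure_eq_measure)
qed

text \<open>Scaling keeps independence and normality, and variances of independent normals
  add.\<close>

lemma (in prob_space) weighted_sum_indep_centered_normal:
  fixes w :: "'i \<Rightarrow> real"
  assumes "finite I" "I \<noteq> {}" "indep_vars (\<lambda>_. borel) X I" "s > 0"
    and w: "\<And>i. i \<in> I \<Longrightarrow> w i > 0"
    and X: "\<And>i. i \<in> I \<Longrightarrow> distributed M lborel (X i) (normal_density 0 s)"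
  shows "distributed M lborel (\<lambda>\<omega>. \<Sum>i\<in>I. w i * X i \<omega>)
           (normal_density 0 (s * sqrt (\<Sum>i\<in>I. (w i)\<^sup>2)))"
proof -
  have "distributed M lborel (\<lambda>\<omega>. \<Sum>i\<in>I. w i * X i \<omega>)
          (normal_density (\<Sum>i\<in>I. 0) (sqrt (\<Sum>i\<in>I. (w i * s)\<^sup>2)))"
  proof (rule sum_indep_normal)
    show "indep_vars (\<lambda>_. borel) (\<lambda>i \<omega>. w i * X i \<omega>) I"
      using indep_vars_compose2[OF assms(3), of "\<lambda>i x. w i * x" "\<lambda>_. borel"] by simp
    fix i assume i: "i \<in> I"
    show "0 < w i * s"
      using w[OF i] \<open>s > 0\<close> by simp
    show "distributed M lborel (\<lambda>\<omega>. w i * X i \<omega>) (normal_density 0 (w i * s))"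
      using normal_density_affine[OF X[OF i] \<open>s > 0\<close>, of "w i" 0] w[OF i] by simp
  qed (use assms in auto)
  also have "sqrt (\<Sum>i\<in>I. (w i * s)\<^sup>2) = s * sqrt (\<Sum>i\<in>I. (w i)\<^sup>2)"
    using \<open>s > 0\<close>
    by (simp add: power_mult_distrib real_sqrt_mult flip: sum_distrib_right)
  finally show ?thesis by simp
qed

section \<open>Measurability of the iterates\<close>

text \<open>Iterate \<open>k\<close> uses only noise of index below \<open>k\<close>. The restricted
  hypothesis matches \<open>iid_gaussian_noise\<close>, which leaves later variables
  unconstrained.\<close>

lemma iterate_measurable:
  assumes "g \<in> borel_measurable borel" "\<And>j. j < k \<Longrightarrow> e j \<in> borel_measurable M"
  shows "(\<lambda>\<omega>. iterate x0 h g (\<lambda>j. e j \<omega>) k) \<in> borel_measurable M"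
  using assms(2)
proof (induction k)
  case (Suc k)
  note [measurable] = assms(1)
  have [measurable]: "(\<lambda>\<omega>. iterate x0 h g (\<lambda>j. e j \<omega>) k) \<in> borel_measurable M"
    "e k \<in> borel_measurable M"
    using Suc by auto
  show ?case by simp
qed simp

lemma averaged_iterate_measurable:
  assumes "g \<in> borel_measurable borel" "\<And>j. j < N \<Longrightarrow> e j \<in> borel_measurable M"
  shows "(\<lambda>\<omega>. averaged_iterate x0 h g (\<lambda>j. e j \<omega>) N) \<in> borel_measurable M"
  unfolding averaged_iterate_def
  by (intro borel_measurable_divide borel_measurable_sum iterate_measurable assms) auto

text \<open>The mean of \<open>\<Sum>j<N. (N - j) * (a + e j)\<close> in units of its standard deviation,
  for \<open>a = s\<close>.\<close>

definition noise_ratio :: "nat \<Rightarrow> real" where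
  "noise_ratio N = (real N * (real N + 1) / 2) / sqrt (real N * (real N + 1) * (2 * real N + 1) / 6)"

text \<open>The square grows like 3N/4, which is the source of the factor 3/4 in the final
  bound.\<close>

lemma noise_ratio_squared:
  "(noise_ratio N)\<^sup>2 = 3 * real N * (real N + 1) / (2 * (2 * real N + 1))"
proof -
  have "(A / 2)\<^sup>2 / (A * B / 6) = 3 * A / (2 * B)" if "B > 0" for A B :: real
    \<comment> \<open>\<open>A = 0\<close> occurs at \<open>N = 0\<close>, where both sides are 0,
      the left one by division by zero.\<close>
    using that by (cases "A = 0") (simp_all add: field_simps power2_eq_square)
  from this[of "2 * real N + 1" "real N * (real N + 1)"] show ?thesis
    by (simp add: noise_ratio_def power_divide mult.assoc)
qed

section \<open>Failure probability on the hard instance\<close>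

lemma worst_case_failure_prob_ge:
  fixes R L s \<epsilon> :: real
  assumes "R > 0" "s > 0" "0 < \<epsilon>" "\<epsilon> \<le> R * L" "N \<ge> 1" "h0 > 0"
    and noise: "iid_gaussian_noise M e s N"
  shows "worst_case_failure_prob M e x0 R L \<epsilon> h0 N
    \<ge> exp (- (\<epsilon> / (R * s) * noise_ratio N + 1)\<^sup>2 / 2) / sqrt (2 * pi)"
proof -
  interpret prob_space M
    using noise by (simp add: iid_gaussian_noise_def)
  \<comment> \<open>With this slope the gap at \<open>x0\<close> is exactly \<epsilon>, and
    \<open>\<epsilon> \<le> R * L\<close> gives \<open>a \<le> L\<close>.\<close>
  define a where "a = \<epsilon> / R"
  define xs where "xs = x0 - R"
  define f where "f = (\<lambda>x. a * \<bar>x - xs\<bar>)"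
  define g where "g = (\<lambda>x. if x < xs then - a else a)"
  have a: "a > 0" "a \<le> L" "a * R = \<epsilon>"
    using assms by (auto simp: a_def field_simps)
  have "f \<in> problem_class x0 R L"
    unfolding problem_class_def mem_Collect_eq
  proof (intro conjI allI ballI exI)
    show "convex_on UNIV f"
      unfolding f_def using a by (intro convex_on_scaled_abs_diff) auto
    show "is_arg_min f (\<lambda>_. True) xs"
      unfolding f_def using a by (intro is_arg_min_scaled_abs_diff) auto
    show "\<bar>x0 - xs\<bar> \<le> R"
      using \<open>R > 0\<close> by (simp add: xs_def)
    show "\<bar>v\<bar> \<le> L" if "v \<in> subdifferential f x" for v x
      using subdifferential_scaled_abs_diff_bound[OF _ that[unfolded f_def]] a by simp
  qed
  moreover have g_meas: "g \<in> borel_measurable borel"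
    unfolding g_def by measurable
  then have "g \<in> subgradient_oracles f"
    using sign_in_subdifferential_scaled_abs_diff[of a _ xs] a
    by (auto simp: subgradient_oracles_def f_def g_def)
  ultimately have fg: "(f, g) \<in> (SIGMA f : problem_class x0 R L. subgradient_oracles f)"
    by simp
  have min_value: "min_value f = 0"
    using min_value_eqI[OF is_arg_min_scaled_abs_diff[of a xs]] a by (simp add: f_def)

  have indep: "indep_vars (\<lambda>_. borel) e {..<N}"
    and distr: "\<And>k. k < N \<Longrightarrow> distributed M lborel (e k) (normal_density 0 s)"
    using noise by (auto simp: iid_gaussian_noise_def)
  have e_meas: "e k \<in> borel_measurable M" if "k < N" for k
    using distributed_measurable[OF distr[OF that]] by simp
  let ?xA = "\<lambda>\<omega>. averaged_iterate x0 h0 g (\<lambda>k. e k \<omega>) N"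
  define Z where "Z = (\<lambda>\<omega>. \<Sum>j<N. (real N - real j) * e j \<omega>)"
  define \<sigma> where "\<sigma> = s * sqrt (real N * (real N + 1) * (2 * real N + 1) / 6)"
  define t where "t = a / s * noise_ratio N"
  \<comment> \<open>\<open>t * \<sigma>\<close> is the mean of the weighted sum with constant
    gradient \<open>a\<close>; \<open>N \<ge> 1\<close> makes its variance positive.\<close>
  have t: "t * \<sigma> = a * (real N * (real N + 1) / 2)" "t \<ge> 0" "\<sigma> > 0"
    using \<open>s > 0\<close> \<open>N \<ge> 1\<close> a by (auto simp: t_def \<sigma>_def noise_ratio_def)
  have Z: "distributed M lborel Z (normal_density 0 \<sigma>)"
    unfolding Z_def \<sigma>_def sum_reversed_index_squares[symmetric]
    using \<open>N \<ge> 1\<close> \<open>s > 0\<close>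
    by (intro weighted_sum_indep_centered_normal indep distr) (auto simp: lessThan_empty_iff)

  have xA_ge: "?xA \<omega> \<ge> x0" if "Z \<omega> \<le> - (t * \<sigma>)" for \<omega>
  proof (rule averaged_iterate_ge)
    have "(\<Sum>j<N. (real N - real j) * (a + e j \<omega>)) = a * (\<Sum>j<N. real N - real j) + Z \<omega>"
      by (simp add: Z_def distrib_left sum.distrib sum_distrib_left mult.commute)
    then show "(\<Sum>j<N. (real N - real j) * (a + e j \<omega>)) \<le> 0"
      using that t by (simp add: sum_reversed_index)
  qed (use a \<open>h0 > 0\<close> in \<open>auto simp: g_def\<close>)
  have failure: "f x - min_value f \<ge> \<epsilon>" if "x \<ge> x0" for x
  proof -
    have "a * R \<le> a * \<bar>x - xs\<bar>"
      using that a by (intro mult_left_mono) (auto simp: xs_def)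
    then show ?thesis
      by (simp add: min_value a) (simp add: f_def)
  qed
  have [measurable]: "?xA \<in> borel_measurable M"
    by (rule averaged_iterate_measurable[OF g_meas e_meas])
  have "exp (- (t + 1)\<^sup>2 / 2) / sqrt (2 * pi) \<le> prob {\<omega> \<in> space M. Z \<omega> \<le> - (t * \<sigma>)}"
    by (rule normal_lower_tail_ge[OF Z t(3,2)])
  also have "\<dots> \<le> prob {\<omega> \<in> space M. f (?xA \<omega>) - min_value f \<ge> \<epsilon>}"
  proof (rule finite_measure_mono)
    show "{\<omega> \<in> space M. f (?xA \<omega>) - min_value f \<ge> \<epsilon>} \<in> events"
      unfolding f_def by measurable
  qed (use xA_ge failure in blast)
  also have "\<dots> \<le> worst_case_failure_prob M e x0 R L \<epsilon> h0 N"
    \<comment> \<open>The real supremum dominates its members because probabilities are bounded by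
      1.\<close>
    unfolding worst_case_failure_prob_def
    by (rule cSUP_upper2[OF _ fg]) (auto intro!: bdd_aboveI2[where M = 1])
  finally show ?thesis
    by (simp add: t_def a_def)
qed

section \<open>Passage to the exponent and its asymptotics\<close>

text \<open>The positive lower bound excludes the case of exponent infinity; the rest is
  monotonicity of \<open>ln\<close>.\<close>

lemma error_exponent_le:
  assumes "worst_case_failure_prob M e x0 R L \<epsilon> h0 N \<ge> exp (- u) / c" and "c > 0"
  shows "error_exponent M e x0 R L \<epsilon> h0 N \<le> ereal (u + ln c)"
proof -
  let ?p = "worst_case_failure_prob M e x0 R L \<epsilon> h0 N"
  have pos: "exp (- u) / c > 0"
    using \<open>c > 0\<close> by simp
  then have "?p > 0"
    using assms(1) by (rule less_le_trans)
  moreover have "ln (exp (- u) / c) \<le> ln ?p"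
    using pos assms(1) \<open>?p > 0\<close> by (subst ln_le_cancel_iff)
  ultimately show ?thesis
    using \<open>c > 0\<close> by (simp add: error_exponent_def Let_def ln_div)
qed

theorem corollary1:
  fixes R L s \<epsilon> :: real
  assumes "R > 0" and "L > 0" and "s > 0"
    and "0 < \<epsilon>" and "\<epsilon> \<le> R * L"
  shows "\<exists>\<delta> :: nat \<Rightarrow> real. \<delta> \<longlonglongrightarrow> 0 \<and>
    (\<forall>N\<ge>1. \<forall>h0>0. \<forall>x0 :: real. \<forall>(M :: 'a measure) (e :: nat \<Rightarrow> 'a \<Rightarrow> real).
       iid_gaussian_noise M e s N \<longrightarrow>
       error_exponent M e x0 R L \<epsilon> h0 N
         \<le> ereal (3 / 4 * (\<epsilon>\<^sup>2 * real N / (2 * R\<^sup>2 * s\<^sup>2)) * (1 + \<delta> N)))"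
proof -
  define c where "c = \<epsilon> / (R * s)"
  have "c > 0"
    using assms by (simp add: c_def)
  define B where "B N = (c * noise_ratio N + 1)\<^sup>2 / 2 + ln (sqrt (2 * pi))" for N
  \<comment> \<open>The relative error of \<open>B\<close> against its leading term. It depends only
    on \<open>N\<close> and \<open>c\<close>, hence the uniformity in \<open>h0\<close>,
    \<open>x0\<close> and the noise model.\<close>
  define \<delta> where "\<delta> N = B N / (3 / 8 * c\<^sup>2 * real N) - 1" for N
  \<comment> \<open>Expanding the square isolates the linear term in \<open>N\<close>;
    \<open>c * noise_ratio N\<close> is of order sqrt N and the rest is constant.\<close>
  have "B N = c\<^sup>2 / 2 * (3 * real N * (real N + 1) / (2 * (2 * real N + 1)))
      + c * noise_ratio N + 1 / 2 + ln (sqrt (2 * pi))" for N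
    unfolding B_def noise_ratio_squared[symmetric]
    by (simp add: power2_sum power_mult_distrib add_divide_distrib)
  then have "\<delta> \<longlonglongrightarrow> 0"
    unfolding \<delta>_def noise_ratio_def using \<open>c > 0\<close> by simp real_asymp
  moreover have "error_exponent M e x0 R L \<epsilon> h0 N
      \<le> ereal (3 / 4 * (\<epsilon>\<^sup>2 * real N / (2 * R\<^sup>2 * s\<^sup>2)) * (1 + \<delta> N))"
    if "N \<ge> 1" "h0 > 0" "iid_gaussian_noise M e s N"
    for N h0 x0 and M :: "'a measure" and e
  proof -
    have "error_exponent M e x0 R L \<epsilon> h0 N \<le> ereal (B N)"
      unfolding B_def c_def
      using worst_case_failure_prob_ge[OF assms(1,3,4,5) that]
      by (intro error_exponent_le) auto
    also have "B N = 3 / 8 * c\<^sup>2 * real N * (1 + \<delta> N)"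
      using \<open>c > 0\<close> \<open>N \<ge> 1\<close> by (simp add: \<delta>_def)
    also have "3 / 8 * c\<^sup>2 * real N = 3 / 4 * (\<epsilon>\<^sup>2 * real N / (2 * R\<^sup>2 * s\<^sup>2))"
      by (simp add: c_def power_divide power_mult_distrib)
    finally show ?thesis .
  qed
  ultimately show ?thesis
    by blast
qed

end
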